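(* Let $F:\mathbb{R}^n_+\to\mathbb{R}_+$ be an arbitrary nonnegative function. Then $F$ belongs to $\mathfrak{F}^n_i$ if and only if there exists $g\in\mathcal{W}$ such that $$F(\bar{\varepsilon})=\omega(g,\bar{\varepsilon})$$ for every $\bar{\varepsilon}\in\mathbb{R}^n_+$.
   Context: $\mathbb{R}_+=[0,\infty)$, $n\ge 1$. For $\bar{x},\bar{y}\in\mathbb{R}^n_+$, $\bar{x}\leqslant\bar{y}$ means $x_i\leqslant y_i$ for every $i$, and $|\bar{x}-\bar{y}|:=(|x_1-y_1|,\dots,|x_n-y_n|)\in\mathbb{R}^n_+$. A function $f:\mathbb{R}^n_+\to\mathbb{R}_+$ is isotone if $\bar{x}\leqslant\bar{y}$ implies $f(\bar{x})\leqslant f(\bar{y})$. A function $\Phi:\mathbb{R}^n_+\to\mathbb{R}_+$ is metric preserving if for every collection of metric spaces $(X_1,d_{X_1}),\dots,(X_n,d_{X_n})$ the function $((x_1,\dots,x_n),(y_1,\dots,y_n))\mapsto\Phi(d_{X_1}(x_1,y_1),\dots,d_{X_n}(x_n,y_n))$ is a metric on $X_1\times\cdots\times X_n$. $\mathfrak{F}^n_i$ denotes the set of isotone metric preserving functions $\mathbb{R}^n_+\to\mathbb{R}_+$. A mapping $f:(X,d)\to(Y,\rho)$ of metric spaces is bornologous if for every $\varepsilon\in\mathbb{R}_+$ there is $\delta\in\mathbb{R}_+$ such that $d(x,y)\leqslant\varepsilon$ implies $\rho(f(x),f(y))\leqslant\delta$ for all $x,y\in X$. Here $\mathbb{R}^n_+$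 carries the metric $\sum_{i=1}^n|x_i-y_i|$ (any metric induced by a norm gives the same notion) and $\mathbb{R}_+$ the metric $|s-t|$. A function $f:\mathbb{R}^n_+\to\mathbb{R}_+$ is nonconstant with respect to the variable $x_i$ if there exist nonnegative numbers $a_j$, $j\neq i$, such that the one-variable function on $\mathbb{R}_+$ obtained from $f$ by fixing $x_j=a_j$ for all $j\neq i$ is nonconstant. $\mathcal{W}$ denotes the family of all bornologous functions $g:\mathbb{R}^n_+\to\mathbb{R}_+$ that are nonconstant with respect to every variable. For $g\in\mathcal{W}$ and $\bar{\varepsilon}\in\mathbb{R}^n_+$, $$\omega(g,\bar{\varepsilon}):=\sup\{|g(\bar{x})-g(\bar{y})|:\bar{x},\bar{y}\in\mathbb{R}^n_+,\ |\bar{x}-\bar{y}|\leqslant\bar{\varepsilon}\}.$$ *)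

theory Defs
  imports "HOL-Analysis.Analysis"
begin

text \<open>
  \<open>\<real>\<^sup>n\<close> is \<open>real ^ 'n\<close> with its componentwise order and absolute value, so \<open>n = CARD('n) \<ge> 1\<close>.
  Functions on the orthant are total functions on \<open>real ^ 'n\<close>; none of the notions below
  looks at values outside the orthant.
\<close>

abbreviation orthant :: "(real ^ 'n) set" where
  "orthant \<equiv> {x. 0 \<le> x}"

abbreviation nonneg_reals :: "real set" where
  "nonneg_reals \<equiv> {0..}"

definition isotone :: "(real ^ 'n \<Rightarrow> real) \<Rightarrow> bool" where
  "isotone f \<longleftrightarrow> (\<forall>x\<in>orthant. \<forall>y\<in>orthant. x \<le> y \<longrightarrow> f x \<le> f y)"

text \<open>
  A definition cannot quantify over types, so the points of the metric spaces
  \<open>(X i, d i)\<close> are drawn from a type \<open>'p\<close>, recorded by the first argument. The spaces are arbitrary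
  subsets of \<open>'p\<close> with arbitrary metrics, and may differ from one index to another. By
  \<open>metric_preserving_any_type\<close> below, a function that is metric preserving for one infinite
  \<open>'p\<close> is metric preserving for every type of points.
\<close>

definition metric_preserving :: "'p itself \<Rightarrow> (real ^ 'n \<Rightarrow> real) \<Rightarrow> bool" where
  "metric_preserving _ \<Phi> \<longleftrightarrow>
     \<Phi> \<in> orthant \<rightarrow> nonneg_reals \<and>
     (\<forall>(X :: 'n \<Rightarrow> 'p set) (d :: 'n \<Rightarrow> 'p \<Rightarrow> 'p \<Rightarrow> real).
        (\<forall>i. Metric_space (X i) (d i)) \<longrightarrow>
        Metric_space {x. \<forall>i. x i \<in> X i} (\<lambda>x y. \<Phi> (\<chi> i. d i (x i) (y i))))"

definition isotone_metric_preserving :: "'p itself \<Rightarrow> (real ^ 'n \<Rightarrow> real) set" where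
  "isotone_metric_preserving P = {\<Phi>. metric_preserving P \<Phi> \<and> isotone \<Phi>}"

definition bornologous ::
  "'a set \<Rightarrow> ('a \<Rightarrow> 'a \<Rightarrow> real) \<Rightarrow> 'b set \<Rightarrow> ('b \<Rightarrow> 'b \<Rightarrow> real) \<Rightarrow> ('a \<Rightarrow> 'b) \<Rightarrow> bool" where
  "bornologous X d Y \<rho> f \<longleftrightarrow>
     f \<in> X \<rightarrow> Y \<and>
     (\<forall>\<epsilon>\<ge>0. \<exists>\<delta>\<ge>0. \<forall>x\<in>X. \<forall>y\<in>X. d x y \<le> \<epsilon> \<longrightarrow> \<rho> (f x) (f y) \<le> \<delta>)"

definition l1_dist :: "real ^ 'n \<Rightarrow> real ^ 'n \<Rightarrow> real" where
  "l1_dist x y = (\<Sum>i\<in>UNIV. \<bar>x $ i - y $ i\<bar>)"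

definition nonconstant_wrt :: "'n \<Rightarrow> (real ^ 'n \<Rightarrow> real) \<Rightarrow> bool" where
  "nonconstant_wrt i f \<longleftrightarrow>
     (\<exists>a :: 'n \<Rightarrow> real. (\<forall>j. j \<noteq> i \<longrightarrow> 0 \<le> a j) \<and>
        \<not> (\<lambda>t. f (\<chi> j. if j = i then t else a j)) constant_on nonneg_reals)"

definition family_W :: "(real ^ 'n \<Rightarrow> real) set" where
  "family_W = {g. bornologous orthant l1_dist nonneg_reals dist g \<and> (\<forall>i. nonconstant_wrt i g)}"

text \<open>
  The supremum is the real one, which is meaningful only for nonempty sets that are bounded above;
  for bornologous \<open>g\<close> and \<open>\<epsilon>\<close> in the orthant this is \<open>modulus_set_nonempty\<close> and
  \<open>modulus_set_bdd_above\<close>.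
\<close>

definition modulus :: "(real ^ 'n \<Rightarrow> real) \<Rightarrow> real ^ 'n \<Rightarrow> real" where
  "modulus g \<epsilon> = Sup {\<bar>g x - g y\<bar> | x y. x \<in> orthant \<and> y \<in> orthant \<and> \<bar>x - y\<bar> \<le> \<epsilon>}"

lemma modulus_set_nonempty:
  fixes g :: "real ^ 'n \<Rightarrow> real"
  assumes "\<epsilon> \<in> orthant"
  shows "{\<bar>g x - g y\<bar> | x y. x \<in> orthant \<and> y \<in> orthant \<and> \<bar>x - y\<bar> \<le> \<epsilon>} \<noteq> {}"
proof -
  have "(0 :: real ^ 'n) \<in> orthant \<and> \<bar>0 - 0 :: real ^ 'n\<bar> \<le> \<epsilon>"
    using assms by simp
  then show ?thesis by blast
qed

lemma modulus_set_bdd_above: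
  fixes g :: "real ^ 'n \<Rightarrow> real"
  assumes "bornologous orthant l1_dist nonneg_reals dist g" and "\<epsilon> \<in> orthant"
  shows "bdd_above {\<bar>g x - g y\<bar> | x y. x \<in> orthant \<and> y \<in> orthant \<and> \<bar>x - y\<bar> \<le> \<epsilon>}"
proof -
  have "0 \<le> (\<Sum>i\<in>UNIV. \<epsilon> $ i)"
    using assms(2) by (auto intro!: sum_nonneg simp: less_eq_vec_def)
  with assms(1) obtain \<delta> where \<delta>: "\<And>x y. x \<in> orthant \<Longrightarrow> y \<in> orthant \<Longrightarrow>
      l1_dist x y \<le> (\<Sum>i\<in>UNIV. \<epsilon> $ i) \<Longrightarrow> dist (g x) (g y) \<le> \<delta>"
    unfolding bornologous_def by meson
  have "\<bar>g x - g y\<bar> \<le> \<delta>" if "x \<in> orthant" "y \<in> orthant" "\<bar>x - y\<bar> \<le> \<epsilon>" for x y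
  proof -
    have "l1_dist x y \<le> (\<Sum>i\<in>UNIV. \<epsilon> $ i)"
      using that(3) unfolding l1_dist_def by (intro sum_mono) (auto simp: less_eq_vec_def abs_vec_def)
    then show ?thesis using \<delta>[OF that(1,2)] by (simp add: dist_real_def)
  qed
  then show ?thesis by (intro bdd_aboveI[where M = \<delta>]) auto
qed

lemma metric_preserving_any_type:
  fixes \<Phi> :: "real ^ 'n \<Rightarrow> real"
  assumes inf: "infinite (UNIV :: 'p set)" and mp: "metric_preserving TYPE('p) \<Phi>"
  shows "metric_preserving TYPE('q) \<Phi>"
proof -
  have nn: "\<Phi> \<in> orthant \<rightarrow> nonneg_reals"
    and pres: "\<And>(X :: 'n \<Rightarrow> 'p set) d. (\<And>i. Metric_space (X i) (d i)) \<Longrightarrow>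
        Metric_space {x. \<forall>i. x i \<in> X i} (\<lambda>x y. \<Phi> (\<chi> i. d i (x i) (y i)))"
    using mp unfolding metric_preserving_def by blast+
  have "Metric_space {x. \<forall>i. x i \<in> X i} (\<lambda>x y. \<Phi> (\<chi> i. d i (x i) (y i)))"
    if ms: "\<And>i. Metric_space (X i) (d i)" for X :: "'n \<Rightarrow> 'q set" and d
  proof -
    let ?D = "\<lambda>x y. \<Phi> (\<chi> i. d i (x i) (y i))"
    have key: "(?D x y = 0 \<longleftrightarrow> x = y) \<and> ?D x z \<le> ?D x y + ?D y z"
      if x: "\<forall>i. x i \<in> X i" and y: "\<forall>i. y i \<in> X i" and z: "\<forall>i. z i \<in> X i" for x y z
    proof -
      let ?S = "\<lambda>i. {x i, y i, z i}"
      have "\<exists>h :: 'q \<Rightarrow> 'p. inj_on h (?S i)" for i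
      proof -
        obtain B :: "'p set" where B: "finite B" "card B = card (?S i)"
          using infinite_arbitrarily_large[OF inf] by blast
        then obtain h where "bij_betw h (?S i) B"
          by (metis bij_betw_iff_card finite.emptyI finite.insertI)
        then show ?thesis by (auto simp: bij_betw_def)
      qed
      then obtain h :: "'n \<Rightarrow> 'q \<Rightarrow> 'p" where h: "\<And>i. inj_on (h i) (?S i)" by metis
      define k where "k i = inv_into (?S i) (h i)" for i
      define e where "e i u v = d i (k i u) (k i v)" for i u v
      have kh: "k i (h i s) = s" if "s \<in> ?S i" for i s
        unfolding k_def by (rule inv_into_f_f[OF h that])
      have SX: "?S i \<subseteq> X i" for i using x y z by auto
      have "Metric_space (h i ` ?S i) (e i)" for i
      proof
        interpret Metric_space "X i" "d i" by (rule ms)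
        show "0 \<le> e i u v" "e i u v = e i v u" for u v
          by (auto simp: e_def commute)
        show "e i u v = 0 \<longleftrightarrow> u = v" if uv: "u \<in> h i ` ?S i" "v \<in> h i ` ?S i" for u v
        proof -
          obtain s t where "s \<in> ?S i" "t \<in> ?S i" "u = h i s" "v = h i t" using uv by blast
          then show ?thesis using kh[of s i] kh[of t i] SX[of i]
            unfolding e_def by (metis subsetD zero)
        qed
        show "e i u w \<le> e i u v + e i v w"
          if uvw: "u \<in> h i ` ?S i" "v \<in> h i ` ?S i" "w \<in> h i ` ?S i" for u v w
        proof -
          obtain s t r where "s \<in> ?S i" "t \<in> ?S i" "r \<in> ?S i" "u = h i s" "v = h i t" "w = h i r"
            using uvw by blast
          then show ?thesis using kh[of s i] kh[of t i] kh[of r i] SX[of i]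
            unfolding e_def by (metis subsetD triangle)
        qed
      qed
      then have "Metric_space {x. \<forall>i. x i \<in> h i ` ?S i} (\<lambda>x y. \<Phi> (\<chi> i. e i (x i) (y i)))"
        by (rule pres)
      then interpret E: Metric_space "{x. \<forall>i. x i \<in> h i ` ?S i}" "\<lambda>x y. \<Phi> (\<chi> i. e i (x i) (y i))" .
      let ?x = "\<lambda>i. h i (x i)" and ?y = "\<lambda>i. h i (y i)" and ?z = "\<lambda>i. h i (z i)"
      have mem: "?x \<in> {x. \<forall>i. x i \<in> h i ` ?S i}" "?y \<in> {x. \<forall>i. x i \<in> h i ` ?S i}"
        "?z \<in> {x. \<forall>i. x i \<in> h i ` ?S i}" by auto
      have "?x = ?y \<longleftrightarrow> x = y"
        using kh by (metis ext insertCI)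
      then show ?thesis
        using E.zero[OF mem(1,2)] E.triangle[OF mem] by (simp add: e_def kh)
    qed
    show ?thesis
    proof
      show "0 \<le> ?D x y" for x y
        using nn Metric_space.nonneg[OF ms] by (auto simp: Pi_iff less_eq_vec_def)
      show "?D x y = ?D y x" for x y
        using Metric_space.commute[OF ms] by (metis (no_types, lifting))
    qed (use key in blast)+
  qed
  with nn show ?thesis unfolding metric_preserving_def by blast
qed

end

theory Submission
  imports Defs
begin

text \<open>
  An isotone function is metric preserving iff it vanishes only at the origin and is subadditive.
  Such an \<open>F\<close> satisfies \<open>\<bar>F x - F y\<bar> \<le> F \<bar>x - y\<bar>\<close>, with equality for \<open>y = 0\<close>, so it is its own
  modulus of continuity and \<open>g = F\<close> works. Conversely, the modulus of any \<open>g\<close> is isotone; it is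
  subadditive because \<open>\<bar>x - y\<bar> \<le> \<epsilon> + \<delta>\<close> allows an intermediate point within \<open>\<epsilon>\<close> of \<open>x\<close> and \<open>\<delta>\<close>
  of \<open>y\<close>; and it vanishes only at the origin because \<open>modulus g \<epsilon> = 0\<close> with \<open>\<epsilon> $ i > 0\<close> would make
  \<open>g\<close> constant along the \<open>i\<close>-th axis.
\<close>

section \<open>Isotone metric preserving functions: zeros and subadditivity\<close>

lemma isotone_metric_preserving_iff:
  fixes F :: "real ^ 'n \<Rightarrow> real"
  assumes inf: "infinite (UNIV :: 'p set)"
    and nonneg: "F \<in> orthant \<rightarrow> nonneg_reals"
  shows "F \<in> isotone_metric_preserving TYPE('p) \<longleftrightarrow>
    isotone F \<and> (\<forall>x\<in>orthant. F x = 0 \<longleftrightarrow> x = 0) \<and>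
    (\<forall>x\<in>orthant. \<forall>y\<in>orthant. F (x + y) \<le> F x + F y)" (is "?L \<longleftrightarrow> ?R")
proof
  assume ?L
  then have iso: "isotone F" and mp: "metric_preserving TYPE('p) F"
    by (auto simp: isotone_metric_preserving_def)
  \<comment> \<open>The real line with its usual metric can serve as every factor, because
    \<open>'p\<close> is infinite. Each vector of the orthant is then the vector of coordinate
    distances from the origin to itself, so the metric axioms speak about all values of
    \<open>F\<close> there.\<close>
  have "metric_preserving TYPE(real) F"
    using metric_preserving_any_type[OF inf mp] .
  moreover have "Metric_space (UNIV :: real set) dist"
    by (simp add: Met_TC.Metric_space_axioms)
  ultimately have "Metric_space {x :: 'n \<Rightarrow> real. \<forall>i. x i \<in> UNIV} (\<lambda>x y. F (\<chi> i. dist (x i) (y i)))"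
    unfolding metric_preserving_def by (elim conjE allE[where x = "\<lambda>_. UNIV"]) auto
  then interpret M: Metric_space "UNIV :: ('n \<Rightarrow> real) set" "\<lambda>x y. F (\<chi> i. dist (x i) (y i))"
    by simp
  have "F x = 0 \<longleftrightarrow> x = 0" if "x \<in> orthant" for x
  proof -
    have "(\<chi> i. dist (x $ i) 0) = x"
      using that by (simp add: vec_eq_iff less_eq_vec_def)
    moreover have "(($) x) = (\<lambda>_. 0) \<longleftrightarrow> x = 0"
      by (simp add: vec_eq_iff fun_eq_iff)
    ultimately show ?thesis
      using M.zero[of "($) x" "\<lambda>_. 0"] by simp
  qed
  moreover have "F (x + y) \<le> F x + F y" if "x \<in> orthant" "y \<in> orthant" for x y
  proof -
    have "0 \<le> x $ i" "0 \<le> y $ i" for i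
      using that by (simp_all add: less_eq_vec_def)
    \<comment> \<open>In each coordinate, 0, x, x + y lie in this order on the line. The triangle
      inequality for these three points is therefore exactly subadditivity at x, y.\<close>
    then have "(\<chi> i. dist (x $ i) 0) = x" "(\<chi> i. dist (x $ i) ((x + y) $ i)) = y"
      "(\<chi> i. dist ((x + y) $ i) 0) = x + y"
      by (simp_all add: vec_eq_iff dist_real_def)
    then show ?thesis
      using M.triangle[of "\<lambda>_. 0" "($) x" "($) (x + y)"] by (simp add: dist_commute[of 0])
  qed
  ultimately show ?R using iso by blast
next
  assume R: ?R
  then have mono: "F x \<le> F y" if "x \<in> orthant" "y \<in> orthant" "x \<le> y" for x y
    using that unfolding isotone_def by blast
  have "Metric_space {x. \<forall>i. x i \<in> X i} (\<lambda>x y. F (\<chi> i. d i (x i) (y i)))"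
    if ms: "\<And>i. Metric_space (X i) (d i)" for X :: "'n \<Rightarrow> 'p set" and d
  proof
    let ?D = "\<lambda>x y. \<chi> i. d i (x i) (y i)"
    have D: "?D x y \<in> orthant" for x y
      using Metric_space.nonneg[OF ms] by (auto simp: less_eq_vec_def)
    show "0 \<le> F (?D x y)" for x y
      using nonneg D[of x y] by (auto simp: Pi_iff)
    show "F (?D x y) = F (?D y x)" for x y
      using Metric_space.commute[OF ms] by (metis (no_types, lifting))
    show "F (?D x y) = 0 \<longleftrightarrow> x = y"
      if "x \<in> {x. \<forall>i. x i \<in> X i}" "y \<in> {x. \<forall>i. x i \<in> X i}" for x y
    proof -
      have "F (?D x y) = 0 \<longleftrightarrow> ?D x y = 0" using R D by blast
      also have "\<dots> \<longleftrightarrow> x = y"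
        using that Metric_space.zero[OF ms] by (auto simp: vec_eq_iff fun_eq_iff)
      finally show ?thesis .
    qed
    show "F (?D x z) \<le> F (?D x y) + F (?D y z)"
      if "x \<in> {x. \<forall>i. x i \<in> X i}" "y \<in> {x. \<forall>i. x i \<in> X i}" "z \<in> {x. \<forall>i. x i \<in> X i}" for x y z
    proof -
      \<comment> \<open>The triangle inequality holds factor by factor. Isotonicity carries
        \<open>F\<close> across it, and subadditivity then splits the right-hand side.\<close>
      have "?D x z \<le> ?D x y + ?D y z"
        using that Metric_space.triangle[OF ms] by (auto simp: less_eq_vec_def)
      moreover have "?D x y + ?D y z \<in> orthant"
        using D[of x y] D[of y z] by simp
      ultimately have "F (?D x z) \<le> F (?D x y + ?D y z)"
        using mono D by blast
      also have "\<dots> \<le> F (?D x y) + F (?D y z)" using R D by blast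
      finally show ?thesis .
    qed
  qed
  with nonneg R show ?L
    unfolding isotone_metric_preserving_def metric_preserving_def by blast
qed

section \<open>Properties of the modulus of continuity\<close>

lemma abs_diff_le_modulus:
  assumes "bornologous orthant l1_dist nonneg_reals dist g"
    and "x \<in> orthant" "y \<in> orthant" "\<bar>x - y\<bar> \<le> \<epsilon>"
  shows "\<bar>g x - g y\<bar> \<le> modulus g \<epsilon>"
proof -
  have "\<epsilon> \<in> orthant"
    using assms(4) order_trans[OF abs_ge_zero] by simp
  from modulus_set_bdd_above[OF assms(1) this] show ?thesis
    unfolding modulus_def by (rule cSup_upper[rotated]) (use assms in blast)
qed

lemma modulus_le:
  assumes "\<epsilon> \<in> orthant"
    and "\<And>x y. x \<in> orthant \<Longrightarrow> y \<in> orthant \<Longrightarrow> \<bar>x - y\<bar> \<le> \<epsilon> \<Longrightarrow> \<bar>g x - g y\<bar> \<le> c"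
  shows "modulus g \<epsilon> \<le> c"
  unfolding modulus_def
  using modulus_set_nonempty[OF assms(1)] by (rule cSup_least) (use assms(2) in blast)

lemma isotone_modulus:
  fixes g :: "real ^ 'n \<Rightarrow> real"
  assumes "bornologous orthant l1_dist nonneg_reals dist g"
  shows "isotone (modulus g)"
  unfolding isotone_def
proof (intro ballI impI)
  fix \<epsilon> \<delta> :: "real ^ 'n"
  assume "\<epsilon> \<in> orthant" "\<epsilon> \<le> \<delta>"
  then show "modulus g \<epsilon> \<le> modulus g \<delta>"
    by (intro modulus_le abs_diff_le_modulus[OF assms]) (auto intro: order_trans)
qed

lemma modulus_subadditive:
  fixes \<epsilon> \<delta> :: "real ^ 'n"
  assumes g: "bornologous orthant l1_dist nonneg_reals dist g"
    and \<epsilon>: "\<epsilon> \<in> orthant" and \<delta>: "\<delta> \<in> orthant"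
  shows "modulus g (\<epsilon> + \<delta>) \<le> modulus g \<epsilon> + modulus g \<delta>"
proof (rule modulus_le)
  show "\<epsilon> + \<delta> \<in> orthant" using \<epsilon> \<delta> by simp
next
  fix x y :: "real ^ 'n"
  assume xy: "x \<in> orthant" "y \<in> orthant" "\<bar>x - y\<bar> \<le> \<epsilon> + \<delta>"
  \<comment> \<open>Each coordinate of y is clamped to the interval of radius
    \<open>\<epsilon> $ i\<close> around \<open>x $ i\<close>. The result lies between
    \<open>x $ i\<close> and \<open>y $ i\<close>, hence stays nonnegative, and at most
    \<open>\<delta> $ i\<close> of the distance to \<open>y $ i\<close> is left.\<close>
  define z where "z = (\<chi> i. max (x $ i - \<epsilon> $ i) (min (x $ i + \<epsilon> $ i) (y $ i)))"
  have "0 \<le> z $ i \<and> \<bar>x $ i - z $ i\<bar> \<le> \<epsilon> $ i \<and> \<bar>z $ i - y $ i\<bar> \<le> \<delta> $ i" for i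
  proof -
    have "0 \<le> x $ i" "0 \<le> y $ i" "0 \<le> \<epsilon> $ i" "0 \<le> \<delta> $ i" "\<bar>x $ i - y $ i\<bar> \<le> \<epsilon> $ i + \<delta> $ i"
      using xy \<epsilon> \<delta> by (auto simp: less_eq_vec_def abs_vec_def)
    then show ?thesis by (auto simp: z_def max_def min_def)
  qed
  then have z: "z \<in> orthant" "\<bar>x - z\<bar> \<le> \<epsilon>" "\<bar>z - y\<bar> \<le> \<delta>"
    by (auto simp: less_eq_vec_def abs_vec_def)
  have "\<bar>g x - g z\<bar> \<le> modulus g \<epsilon>" "\<bar>g z - g y\<bar> \<le> modulus g \<delta>"
    using abs_diff_le_modulus[OF g] xy z by blast+
  then show "\<bar>g x - g y\<bar> \<le> modulus g \<epsilon> + modulus g \<delta>" by linarith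
qed

text \<open>From any t, finitely many steps of length at most c lead down to 0, and no step changes
  the value. The induction is on the number of steps.\<close>

lemma uniformly_locally_constant_imp_constant_on_nonneg_reals:
  fixes h :: "real \<Rightarrow> 'a"
  assumes "0 < c" and h: "\<And>s t. 0 \<le> s \<Longrightarrow> 0 \<le> t \<Longrightarrow> \<bar>s - t\<bar> \<le> c \<Longrightarrow> h s = h t"
  shows "h constant_on nonneg_reals"
proof -
  have *: "h t = h 0" if "0 \<le> t" "t \<le> real n * c" for n t
    using that
  proof (induction n arbitrary: t)
    case (Suc n)
    \<comment> \<open>The maximum with 0 keeps the last step from leaving the domain.\<close>
    let ?s = "max 0 (t - c)"
    have "h t = h ?s"
      using Suc.prems \<open>0 < c\<close> by (intro h) auto
    also have "\<dots> = h 0"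
      using Suc.prems \<open>0 < c\<close> by (intro Suc.IH) (auto simp: algebra_simps)
    finally show ?case .
  qed simp
  have "h t = h 0" if "0 \<le> t" for t
  proof -
    obtain n where "t < real n * c"
      using reals_Archimedean3[OF \<open>0 < c\<close>] by blast
    then show ?thesis using *[of t n] that by simp
  qed
  then show ?thesis unfolding constant_on_def by (metis atLeast_iff)
qed

lemma modulus_zero: "modulus g 0 = 0"
proof -
  have "{\<bar>g x - g y\<bar> | x y. x \<in> orthant \<and> y \<in> orthant \<and> \<bar>x - y\<bar> \<le> 0} = {0}"
    by auto
  then show ?thesis by (simp add: modulus_def)
qed

lemma modulus_eq_0_iff:
  assumes g: "g \<in> family_W" and \<epsilon>: "\<epsilon> \<in> orthant"
  shows "modulus g \<epsilon> = 0 \<longleftrightarrow> \<epsilon> = 0"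
proof
  assume 0: "modulus g \<epsilon> = 0"
  have born: "bornologous orthant l1_dist nonneg_reals dist g"
    using g by (simp add: family_W_def)
  show "\<epsilon> = 0"
  proof (rule ccontr)
    assume "\<epsilon> \<noteq> 0"
    with \<epsilon> obtain i where i: "0 < \<epsilon> $ i"
      by (auto simp: vec_eq_iff less_eq_vec_def order_less_le)
    have "nonconstant_wrt i g" using g by (simp add: family_W_def)
    then obtain a where a: "\<And>j. j \<noteq> i \<Longrightarrow> 0 \<le> a j"
      and nc: "\<not> (\<lambda>t. g (\<chi> j. if j = i then t else a j)) constant_on nonneg_reals"
      by (auto simp: nonconstant_wrt_def)
    \<comment> \<open>Two points of this line differ only in coordinate i. If they are at most
      \<open>\<epsilon> $ i\<close> apart, the vanishing modulus forces equal values, so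
      \<open>g\<close> is locally constant along the line with uniform radius
      \<open>\<epsilon> $ i\<close>.\<close>
    have "(\<lambda>t. g (\<chi> j. if j = i then t else a j)) constant_on nonneg_reals"
    proof (rule uniformly_locally_constant_imp_constant_on_nonneg_reals[OF i])
      fix s t :: real
      assume "0 \<le> s" "0 \<le> t" "\<bar>s - t\<bar> \<le> \<epsilon> $ i"
      have "\<bar>g (\<chi> j. if j = i then s else a j) - g (\<chi> j. if j = i then t else a j)\<bar> \<le> modulus g \<epsilon>"
        using \<open>0 \<le> s\<close> \<open>0 \<le> t\<close> \<open>\<bar>s - t\<bar> \<le> \<epsilon> $ i\<close> a \<epsilon>
        by (intro abs_diff_le_modulus[OF born]) (auto simp: less_eq_vec_def abs_vec_def)
      with 0 show "g (\<chi> j. if j = i then s else a j) = g (\<chi> j. if j = i then t else a j)"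
        by simp
    qed
    with nc show False ..
  qed
qed (simp add: modulus_zero)

section \<open>Isotone subadditive functions as their own moduli\<close>

lemma isotone_subadditive_modulus_bound:
  fixes F :: "real ^ 'n \<Rightarrow> real"
  assumes iso: "isotone F"
    and sub: "\<forall>x\<in>orthant. \<forall>y\<in>orthant. F (x + y) \<le> F x + F y"
    and x: "x \<in> orthant" and y: "y \<in> orthant" and le: "\<bar>x - y\<bar> \<le> \<epsilon>"
  shows "\<bar>F x - F y\<bar> \<le> F \<epsilon>"
proof -
  have \<epsilon>: "\<epsilon> \<in> orthant"
    using le order_trans[OF abs_ge_zero] by simp
  \<comment> \<open>The one-sided estimate is used for (x, y) and for (y, x); together they bound
    the absolute value.\<close>
  have "F u \<le> F v + F \<epsilon>" if "u \<in> orthant" "v \<in> orthant" "u \<le> v + \<epsilon>" for u v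
  proof -
    have "v + \<epsilon> \<in> orthant" using that \<epsilon> by simp
    with that iso have "F u \<le> F (v + \<epsilon>)" unfolding isotone_def by blast
    moreover have "F (v + \<epsilon>) \<le> F v + F \<epsilon>" using bspec[OF bspec[OF sub that(2)] \<epsilon>] .
    ultimately show ?thesis by (rule order_trans)
  qed
  moreover have "x \<le> y + \<epsilon>" "y \<le> x + \<epsilon>"
    using le by (auto simp: less_eq_vec_def abs_vec_def abs_le_iff algebra_simps)
  ultimately have "F x \<le> F y + F \<epsilon>" "F y \<le> F x + F \<epsilon>" using x y by blast+
  then show ?thesis by linarith
qed

lemma isotone_subadditive_modulus_eq:
  fixes F :: "real ^ 'n \<Rightarrow> real"
  assumes iso: "isotone F" and nonneg: "F \<in> orthant \<rightarrow> nonneg_reals"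
    and zero: "\<forall>x\<in>orthant. F x = 0 \<longleftrightarrow> x = 0"
    and sub: "\<forall>x\<in>orthant. \<forall>y\<in>orthant. F (x + y) \<le> F x + F y"
  shows "F \<in> family_W" and "\<And>\<epsilon>. \<epsilon> \<in> orthant \<Longrightarrow> modulus F \<epsilon> = F \<epsilon>"
proof -
  note bound = isotone_subadditive_modulus_bound[OF iso, OF sub]
  have "\<exists>\<delta>\<ge>0. \<forall>x\<in>orthant. \<forall>y\<in>orthant. l1_dist x y \<le> e \<longrightarrow> dist (F x) (F y) \<le> \<delta>"
    if "0 \<le> e" for e
  proof (intro exI conjI ballI impI)
    \<comment> \<open>The bornology constant is \<open>F\<close> at the constant vector e: an l1
      distance of at most e bounds every coordinate difference by e.\<close>
    show "0 \<le> F (\<chi> i. e)"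
      using nonneg that by (auto simp: Pi_iff less_eq_vec_def)
    fix x y :: "real ^ 'n"
    assume x: "x \<in> orthant" and y: "y \<in> orthant" and le: "l1_dist x y \<le> e"
    have "\<bar>x $ i - y $ i\<bar> \<le> e" for i
      using le member_le_sum[of i UNIV "\<lambda>i. \<bar>x $ i - y $ i\<bar>"] by (simp add: l1_dist_def)
    then have "\<bar>x - y\<bar> \<le> (\<chi> i. e)"
      by (simp add: less_eq_vec_def abs_vec_def)
    with bound x y show "dist (F x) (F y) \<le> F (\<chi> i. e)"
      by (simp add: dist_real_def)
  qed
  with nonneg have born: "bornologous orthant l1_dist nonneg_reals dist F"
    by (simp add: bornologous_def)
  have "nonconstant_wrt i F" for i
  proof -
    \<comment> \<open>The coordinate axis itself suffices: \<open>F\<close> vanishes at the origin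
      but not at the i-th unit vector.\<close>
    let ?h = "\<lambda>t. F (\<chi> j. if j = i then t else 0)"
    have "?h 0 = 0" "?h 1 \<noteq> 0"
      using zero by (auto simp: less_eq_vec_def vec_eq_iff)
    moreover have "?h 1 = ?h 0" if const: "?h constant_on nonneg_reals"
    proof -
      obtain c where "\<forall>t\<in>nonneg_reals. ?h t = c"
        using const unfolding constant_on_def by blast
      from this[rule_format, of 0] this[rule_format, of 1] show ?thesis by simp
    qed
    ultimately have "\<not> ?h constant_on nonneg_reals" by argo
    then show ?thesis
      unfolding nonconstant_wrt_def by (intro exI[of _ "\<lambda>_. 0"]) simp
  qed
  with born show "F \<in> family_W" by (simp add: family_W_def)
  fix \<epsilon> :: "real ^ 'n" assume \<epsilon>: "\<epsilon> \<in> orthant"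
  show "modulus F \<epsilon> = F \<epsilon>"
  proof (rule antisym)
    show "modulus F \<epsilon> \<le> F \<epsilon>"
      using \<epsilon> bound by (intro modulus_le) auto
    \<comment> \<open>The pair \<epsilon>, 0 attains the supremum.\<close>
    have "\<bar>F \<epsilon> - F 0\<bar> \<le> modulus F \<epsilon>"
      using \<epsilon> by (intro abs_diff_le_modulus[OF born]) (auto simp: less_eq_vec_def abs_vec_def)
    moreover have "F 0 = 0" using zero by simp
    ultimately show "F \<epsilon> \<le> modulus F \<epsilon>" by simp
  qed
qed

theorem theorem4p3:
  fixes F :: "real ^ 'n \<Rightarrow> real"
  assumes "infinite (UNIV :: 'p set)"
    and "F \<in> orthant \<rightarrow> nonneg_reals"
  shows "F \<in> isotone_metric_preserving TYPE('p) \<longleftrightarrow>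
    (\<exists>g\<in>family_W. \<forall>\<epsilon>\<in>orthant. F \<epsilon> = modulus g \<epsilon>)"
proof
  assume "F \<in> isotone_metric_preserving TYPE('p)"
  then have "isotone F" and "\<forall>x\<in>orthant. F x = 0 \<longleftrightarrow> x = 0"
    and "\<forall>x\<in>orthant. \<forall>y\<in>orthant. F (x + y) \<le> F x + F y"
    by (simp_all add: isotone_metric_preserving_iff[OF assms])
  note eq = isotone_subadditive_modulus_eq[OF this(1), OF assms(2) this(2,3)]
  show "\<exists>g\<in>family_W. \<forall>\<epsilon>\<in>orthant. F \<epsilon> = modulus g \<epsilon>"
    using eq by (intro bexI[of _ F]) auto
next
  assume "\<exists>g\<in>family_W. \<forall>\<epsilon>\<in>orthant. F \<epsilon> = modulus g \<epsilon>"
  then obtain g where g: "g \<in> family_W" and F: "\<And>\<epsilon>. \<epsilon> \<in> orthant \<Longrightarrow> F \<epsilon> = modulus g \<epsilon>"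
    by blast
  have born: "bornologous orthant l1_dist nonneg_reals dist g"
    using g by (simp add: family_W_def)
  \<comment> \<open>\<open>F\<close> agrees with \<open>modulus g\<close> on the orthant, which is
    closed under addition, so the three characterizing properties pass from the modulus to
    \<open>F\<close>.\<close>
  have "isotone F"
    using isotone_modulus[OF born] F by (simp add: isotone_def)
  moreover have "F (x + y) \<le> F x + F y" if "x \<in> orthant" "y \<in> orthant" for x y
    using modulus_subadditive[OF born that] that F by simp
  ultimately show "F \<in> isotone_metric_preserving TYPE('p)"
    unfolding isotone_metric_preserving_iff[OF assms]
    using modulus_eq_0_iff[OF g] F by auto
qed

end
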